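(* There is an online algorithm with advice for the proportional removable knapsack problem \textsc{RemKnap} that reads only one advice bit and is strictly $\sqrt{2}$-competitive.
   Context: \textsc{RemKnap} (proportional removable knapsack) is the following online maximization problem. An instance is a sequence of items $1,\dots,n$ with sizes $s_1,\dots,s_n\in\mathbb{R}_{>0}$; the knapsack has capacity $1$. For a set $A$ of items, $s(A)=\sum_{i\in A}s_i$. The items are revealed one by one; the algorithm starts with the empty packing $A_0=\emptyset$, and when item $i$ is revealed (and only then does it learn $s_i$) it must choose a new packing $A_i\subseteq A_{i-1}\cup\{i\}$ with $s(A_i)\le 1$. Thus it may remove any previously packed items and may pack the new item, but a removed or rejected item can never be packed again. The algorithm learns $n$ only after choosing $A_n$. The gain is $\mathrm{ALG}(I)=s(A_n)$; $\mathrm{OPT}(I)$ is the maximum of $s(A)$ over all subsets $A$ of the items with $s(A)\le1$. In the advice model, an omniscient oracle that knows the whole instance writes a binary advice string that the algorithm may read. An algorithm is strictly $\rho$-competitive if $\mathrm{OPT}(I)/\mathrm{ALG}(I)\le\rho$ for every instance $I$. *)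

theory Defs
  imports Complex_Main "HOL-Library.Extended_Real"
begin

text \<open>
  An instance is the list of item sizes in order of arrival. Items are numbered from 0,
  so item \<open>i\<close> has size \<open>I ! i\<close>, and packings are sets of item numbers.
\<close>

definition remknap_instance :: "real list \<Rightarrow> bool" where
  "remknap_instance I \<longleftrightarrow> (\<forall>x\<in>set I. 0 < x)"

definition load :: "real list \<Rightarrow> nat set \<Rightarrow> real" where
  "load I P = (\<Sum>i\<in>P. I ! i)"

definition opt :: "real list \<Rightarrow> real" where
  "opt I = Max {load I P |P. P \<subseteq> {..<length I} \<and> load I P \<le> 1}"

text \<open>
  The advice is an infinite tape, so that its length carries no information.
  For a tape \<open>\<phi>\<close> and the list \<open>I\<close> of sizes revealed so far, \<open>alg \<phi> I\<close> is the packing chosen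
  right after the last item of \<open>I\<close> has been revealed. As only the revealed prefix is an
  argument, the algorithm knows neither future sizes nor the number of items; earlier
  packings are determined by \<open>\<phi>\<close> and the prefixes of \<open>I\<close>.
\<close>

type_synonym advice = "nat \<Rightarrow> bool"
type_synonym advice_algorithm = "advice \<Rightarrow> real list \<Rightarrow> nat set"

text \<open>The item revealed last in \<open>I @ [x]\<close> has number \<open>length I\<close>.\<close>

definition remknap_algorithm :: "advice_algorithm \<Rightarrow> bool" where
  "remknap_algorithm alg \<longleftrightarrow>
     (\<forall>\<phi>. alg \<phi> [] = {} \<and>
       (\<forall>I x. remknap_instance (I @ [x]) \<longrightarrow>
          alg \<phi> (I @ [x]) \<subseteq> alg \<phi> I \<union> {length I} \<and>
          load (I @ [x]) (alg \<phi> (I @ [x])) \<le> 1))"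

text \<open>
  The tape is read sequentially, so reading at most \<open>k\<close> bits means that the behaviour depends
  on no bit after the first \<open>k\<close>.
\<close>

definition reads_at_most :: "nat \<Rightarrow> advice_algorithm \<Rightarrow> bool" where
  "reads_at_most k alg \<longleftrightarrow>
     (\<forall>\<phi> \<psi> I. remknap_instance I \<longrightarrow> (\<forall>j<k. \<phi> j = \<psi> j) \<longrightarrow> alg \<phi> I = alg \<psi> I)"

definition gain :: "advice_algorithm \<Rightarrow> advice \<Rightarrow> real list \<Rightarrow> real" where
  "gain alg \<phi> I = load I (alg \<phi> I)"

text \<open>
  The quotient is taken in the extended reals: there \<open>a / 0 = \<infinity>\<close> for \<open>a > 0\<close>, so an algorithm
  with zero gain violates the bound whenever the optimum is positive, while \<open>0 / 0 = 0\<close>, so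
  instances on which no nonempty packing is feasible impose nothing.
\<close>

definition strictly_competitive ::
    "real \<Rightarrow> advice_algorithm \<Rightarrow> (real list \<Rightarrow> advice) \<Rightarrow> bool" where
  "strictly_competitive \<rho> alg oracle_advice \<longleftrightarrow>
     (\<forall>I. remknap_instance I \<longrightarrow>
        ereal (opt I) / ereal (gain alg (oracle_advice I) I) \<le> ereal \<rho>)"

lemma ereal_ratio_le_iff:
  fixes a b \<rho> :: real
  assumes "0 \<le> a" "0 \<le> b" "0 \<le> \<rho>"
  shows "ereal a / ereal b \<le> ereal \<rho> \<longleftrightarrow> a \<le> \<rho> * b"
proof (cases "b = 0")
  case True
  then show ?thesis
    using assms by (cases "a = 0") (auto simp: divide_ereal_def)
next
  case False
  then show ?thesis
    using assms by (simp add: pos_divide_le_eq)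
qed

end

theory Submission
  imports Defs
begin

text \<open>
  Put \<open>\<tau> = 1 / \<surd>2\<close>. As soon as some subset of the available items has load in \<open>[\<tau>, 1]\<close>, the
  algorithm keeps such a subset forever. Until then it keeps every small item (size at most
  \<open>1 - \<tau>\<close>): dropping small items one by one from an overfull packing cannot jump over
  \<open>[\<tau>, 1]\<close>, so small items never hurt and only the items of size in \<open>(1 - \<tau>, \<tau>)\<close> matter.
  Among those, one bit selects either the two smallest items of size at most \<open>1/2\<close> or the
  smallest item of size above \<open>1/2\<close>. If the optimum contains an item \<open>c > 1/2\<close>, it contains at
  most one further item \<open>x\<close> that is not small. Without such an \<open>x\<close> the second strategy is good,
  as \<open>\<tau>\<^sup>2 = 1/2\<close>. Otherwise the second strategy is good if \<open>c\<close> comes before \<open>x\<close>, and the first one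
  if \<open>x\<close> comes before \<open>c\<close>, since the item kept fits with the later one of the two. If the optimum
  contains no item above \<open>1/2\<close>, the first strategy is good: three items that fit together yield a
  load of at least \<open>\<tau>\<close>, and if two items never do, then both have size below \<open>2\<tau> - 1\<close>, and
  \<open>\<tau> \<cdot> 2(2\<tau> - 1) = 2(1 - \<tau>)\<close>.
\<close>

section \<open>The threshold \<tau> and numerical bounds on it\<close>

definition \<tau> :: real where
  "\<tau> = 1 / sqrt 2"

lemma \<tau>_square: "\<tau> * \<tau> = 1 / 2"
  by (simp add: \<tau>_def)

lemma \<tau>_pos: "0 < \<tau>"
  by (simp add: \<tau>_def)

lemma \<tau>_gt: "7 / 10 < \<tau>"
proof (rule ccontr)
  assume "\<not> 7 / 10 < \<tau>"
  then have "\<tau> * \<tau> \<le> 7 / 10 * (7 / 10)"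
    using \<tau>_pos by (intro mult_mono) auto
  then show False
    by (simp add: \<tau>_square)
qed

text \<open>Below 3/4, both \<open>3 * (1 - \<tau>)\<close> and \<open>1 / 2 + (1 - \<tau>)\<close>
  exceed \<tau>. This makes the pairs and triples in the case analysis heavy enough.\<close>

lemma \<tau>_lt: "\<tau> < 3 / 4"
proof (rule ccontr)
  assume "\<not> \<tau> < 3 / 4"
  then have "3 / 4 * (3 / 4) \<le> \<tau> * \<tau>"
    by (intro mult_mono) auto
  then show False
    by (simp add: \<tau>_square)
qed

lemma sqrt2_mult_\<tau>: "sqrt 2 * (\<tau> * a) = a"
  by (simp add: \<tau>_def)

section \<open>The smallest items of a set\<close>

text \<open>Breaking ties by arrival makes this a strict total order on item numbers, so ranks
  within a finite set are distinct.\<close>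

definition before :: "real list \<Rightarrow> nat \<Rightarrow> nat \<Rightarrow> bool" where
  "before I j i \<longleftrightarrow> I ! j < I ! i \<or> I ! j = I ! i \<and> j < i"

definition smallest :: "nat \<Rightarrow> real list \<Rightarrow> nat set \<Rightarrow> nat set" where
  "smallest k I D = {i \<in> D. card {j \<in> D. before I j i} < k}"

lemma smallest_subset: "smallest k I D \<subseteq> D"
  by (auto simp: smallest_def)

lemma smallest_cong:
  assumes "\<And>i. i \<in> D \<Longrightarrow> I ! i = J ! i"
  shows "smallest k I D = smallest k J D"
proof -
  have "{j \<in> D. before I j i} = {j \<in> D. before J j i}" if "i \<in> D" for i
    using assms that by (auto simp: before_def)
  then show ?thesis
    by (auto simp: smallest_def)
qed

text \<open>Ranks can only grow with the set. Hence an item pushed out of the \<open>k\<close>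
  smallest never returns, as irrevocable removal demands.\<close>

lemma smallest_mono:
  assumes "finite E" "D \<subseteq> E"
  shows "smallest k I E \<inter> D \<subseteq> smallest k I D"
proof
  fix i assume i: "i \<in> smallest k I E \<inter> D"
  have "card {j \<in> D. before I j i} \<le> card {j \<in> E. before I j i}"
    using assms by (intro card_mono) auto
  then show "i \<in> smallest k I D"
    using i by (auto simp: smallest_def)
qed

text \<open>The rank is strictly monotone along \<open>before\<close>, hence injective, and the
  selected items have ranks below \<open>k\<close>.\<close>

lemma card_smallest:
  assumes "finite D"
  shows "card (smallest k I D) \<le> k"
proof -
  let ?rank = "\<lambda>i. card {j \<in> D. before I j i}"
  have less: "?rank i < ?rank j" if "i \<in> D" "j \<in> D" "before I i j" for i j
    using assms that by (intro psubset_card_mono) (auto simp: before_def)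
  have "inj_on ?rank D"
  proof (rule inj_onI, rule ccontr)
    fix i j assume ij: "i \<in> D" "j \<in> D" "?rank i = ?rank j" "i \<noteq> j"
    then have "before I i j \<or> before I j i"
      by (auto simp: before_def)
    then show False
      using less[of i j] less[of j i] ij by auto
  qed
  then have "inj_on ?rank (smallest k I D)"
    using smallest_subset by (rule inj_on_subset)
  moreover have "?rank ` smallest k I D \<subseteq> {..<k}"
    by (auto simp: smallest_def)
  ultimately show ?thesis
    using card_inj_on_le[of ?rank "smallest k I D" "{..<k}"] by simp
qed

lemma ex_first:
  assumes "finite D" "D \<noteq> {}"
  obtains p where "p \<in> D" "\<And>j. j \<in> D \<Longrightarrow> j \<noteq> p \<Longrightarrow> before I p j"
proof -
  let ?m = "Min ((!) I ` D)"
  let ?E = "{i \<in> D. I ! i = ?m}"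
  have "?m \<in> (!) I ` D"
    using assms by (intro Min_in) auto
  then have "?E \<noteq> {}"
    by auto
  then have p: "Min ?E \<in> ?E"
    using assms by (intro Min_in) auto
  have "before I (Min ?E) j" if j: "j \<in> D" "j \<noteq> Min ?E" for j
  proof (cases "I ! j = ?m")
    case True
    then have "Min ?E \<le> j"
      using j assms by (intro Min_le) auto
    then show ?thesis
      using p j True by (auto simp: before_def)
  next
    case False
    moreover have "?m \<le> I ! j"
      using j assms by (intro Min_le) auto
    ultimately show ?thesis
      using p by (auto simp: before_def)
  qed
  then show ?thesis
    using p that by blast
qed

lemma before_imp_le: "before I p j \<Longrightarrow> I ! p \<le> I ! j"
  by (auto simp: before_def)

lemma ex_smallest_le:
  assumes "finite D" "u \<in> D" "0 < k"
  obtains p where "p \<in> smallest k I D" "I ! p \<le> I ! u"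
proof -
  obtain p where p: "p \<in> D" "\<And>j. j \<in> D \<Longrightarrow> j \<noteq> p \<Longrightarrow> before I p j"
    using ex_first[of D] assms by blast
  have "{j \<in> D. before I j p} = {}"
    using p by (fastforce simp: before_def)
  then have "card {j \<in> D. before I j p} < k"
    using assms by (simp only: card.empty)
  then have "p \<in> smallest k I D"
    using p by (simp add: smallest_def)
  moreover have "I ! p \<le> I ! u"
    using p assms before_imp_le by (cases "u = p") auto
  ultimately show ?thesis
    by (rule that)
qed

lemma ex_two_smallest_le:
  assumes "finite D" "u \<in> D" "v \<in> D" "u \<noteq> v" "1 < k"
  obtains p q where "p \<in> smallest k I D" "q \<in> smallest k I D" "p \<noteq> q"
    "I ! p + I ! q \<le> I ! u + I ! v"
proof -
  obtain p where p: "p \<in> D" "\<And>j. j \<in> D \<Longrightarrow> j \<noteq> p \<Longrightarrow> before I p j"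
    using ex_first[of D] assms by blast
  have "D - {p} \<noteq> {}"
    using assms by auto
  then obtain q where q: "q \<in> D - {p}" "\<And>j. j \<in> D - {p} \<Longrightarrow> j \<noteq> q \<Longrightarrow> before I q j"
    using ex_first[of "D - {p}"] assms by blast
  have "{j \<in> D. before I j p} = {}"
    using p by (fastforce simp: before_def)
  then have "card {j \<in> D. before I j p} < k"
    using order.strict_trans[OF zero_less_one \<open>1 < k\<close>] by (simp only: card.empty)
  then have "p \<in> smallest k I D"
    using p by (simp add: smallest_def)
  moreover have "{j \<in> D. before I j q} \<subseteq> {p}"
    using q by (fastforce simp: before_def)
  then have "card {j \<in> D. before I j q} \<le> card {p}"
    by (intro card_mono) auto
  then have "q \<in> smallest k I D"
    using q assms by (simp add: smallest_def)
  moreover have "p \<noteq> q"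
    using q by auto
  moreover have "I ! p \<le> I ! j" if "j \<in> D" for j
    using p that before_imp_le by (cases "j = p") auto
  moreover have "I ! q \<le> I ! j" if "j \<in> D" "j \<noteq> p" for j
    using q that before_imp_le by (cases "j = q") auto
  \<comment> \<open>One of \<open>u\<close>, \<open>v\<close> differs from \<open>p\<close> and is
    therefore at least as large as \<open>q\<close>; the other is at least as large as
    \<open>p\<close>.\<close>
  ultimately show ?thesis
    using that assms by (smt (verit) add_mono)
qed

section \<open>The algorithm\<close>

lemma load_cong:
  assumes "\<And>i. i \<in> P \<Longrightarrow> I ! i = J ! i"
  shows "load I P = load J P"
  using assms by (simp add: load_def)

lemma load_append:
  assumes "P \<subseteq> {..<length I}"
  shows "load (I @ J) P = load I P"
  using assms by (intro load_cong) (auto simp: nth_append)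

lemma load_Un_disjoint:
  "finite A \<Longrightarrow> finite B \<Longrightarrow> A \<inter> B = {} \<Longrightarrow> load I (A \<union> B) = load I A + load I B"
  by (simp add: load_def sum.union_disjoint)

lemma nth_pos: "remknap_instance I \<Longrightarrow> i < length I \<Longrightarrow> 0 < I ! i"
  by (simp add: remknap_instance_def)

lemma load_mono:
  assumes "remknap_instance I" "P \<subseteq> Q" "Q \<subseteq> {..<length I}"
  shows "load I P \<le> load I Q"
  unfolding load_def using assms
  by (intro sum_mono2) (auto simp: finite_subset intro!: less_imp_le nth_pos)

definition in_class :: "bool \<Rightarrow> real \<Rightarrow> bool" where
  "in_class b x \<longleftrightarrow> (if b then 1 / 2 < x \<and> x \<le> 1 else 1 - \<tau> < x \<and> x \<le> 1 / 2)"

text \<open>The largest number of items of the class that are certain to fit together.\<close>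

definition slots :: "bool \<Rightarrow> nat" where
  "slots b = (if b then 1 else 2)"

lemma slots_pos: "0 < slots b"
  by (simp add: slots_def)

definition small :: "real list \<Rightarrow> nat set" where
  "small I = {i. i < length I \<and> I ! i \<le> 1 - \<tau>}"

definition kept :: "bool \<Rightarrow> real list \<Rightarrow> nat set" where
  "kept b I = smallest (slots b) I {i. i < length I \<and> in_class b (I ! i)}"

definition target :: "bool \<Rightarrow> real list \<Rightarrow> nat set" where
  "target b I = small I \<union> kept b I"

text \<open>Since the optimum is at most 1, such a load is within a factor \<open>sqrt 2\<close> of
  it.\<close>

definition good :: "real list \<Rightarrow> nat set \<Rightarrow> bool" where
  "good I B \<longleftrightarrow> \<tau> \<le> load I B \<and> load I B \<le> 1"

lemma good_append: "B \<subseteq> {..<length I} \<Longrightarrow> good (I @ J) B \<longleftrightarrow> good I B"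
  by (simp add: good_def load_append)

text \<open>The recursion runs over the reversed list of the sizes revealed so far.\<close>

primrec packing_rev :: "bool \<Rightarrow> real list \<Rightarrow> nat set" where
  "packing_rev b [] = {}"
| "packing_rev b (x # xs) =
     (let I = rev (x # xs); av = insert (length xs) (packing_rev b xs)
      in if \<exists>B\<subseteq>av. good I B then SOME B. B \<subseteq> av \<and> good I B else target b I)"

definition packing :: "bool \<Rightarrow> real list \<Rightarrow> nat set" where
  "packing b I = packing_rev b (rev I)"

lemma packing_Nil: "packing b [] = {}"
  by (simp add: packing_def)

lemma packing_snoc:
  "packing b (I @ [x]) =
     (let av = insert (length I) (packing b I)
      in if \<exists>B\<subseteq>av. good (I @ [x]) B then SOME B. B \<subseteq> av \<and> good (I @ [x]) B
         else target b (I @ [x]))"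
  by (simp add: packing_def Let_def)

section \<open>Online feasibility of the target packing\<close>

lemma kept_subset: "kept b I \<subseteq> {i. i < length I \<and> in_class b (I ! i)}"
  by (simp add: kept_def smallest_subset)

lemma small_subset: "small I \<subseteq> {..<length I}"
  by (auto simp: small_def)

lemma target_subset: "target b I \<subseteq> {..<length I}"
  using small_subset kept_subset by (force simp: target_def)

lemma finite_small: "finite (small I)"
  using small_subset finite_subset by blast

lemma finite_kept: "finite (kept b I)"
  using kept_subset by (rule finite_subset) auto

lemma small_kept_disjoint: "small I \<inter> kept b I = {}"
  using kept_subset[of b I] \<tau>_gt by (auto simp: small_def in_class_def split: if_splits)

text \<open>By \<open>smallest_mono\<close>, an old item that is kept now was also kept before the
  arrival of \<open>x\<close>, so the target never asks for a removed item.\<close>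

lemma kept_snoc: "kept b (I @ [x]) \<subseteq> insert (length I) (kept b I)"
proof
  let ?D = "{i. i < length I \<and> in_class b (I ! i)}"
  let ?E = "{i. i < length (I @ [x]) \<and> in_class b ((I @ [x]) ! i)}"
  fix i assume i: "i \<in> kept b (I @ [x])"
  show "i \<in> insert (length I) (kept b I)"
  proof (cases "i = length I")
    case False
    with i kept_subset[of b "I @ [x]"] have "i \<in> ?D"
      by (auto simp: nth_append split: if_splits)
    moreover have "?D \<subseteq> ?E"
      by (auto simp: nth_append)
    ultimately have "i \<in> smallest (slots b) (I @ [x]) ?D"
      using i smallest_mono[of ?E ?D "slots b" "I @ [x]"] unfolding kept_def by auto
    also have "\<dots> = kept b I"
      unfolding kept_def by (intro smallest_cong) (auto simp: nth_append)
    finally show ?thesis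
      by simp
  qed simp
qed

lemma target_snoc: "target b (I @ [x]) \<subseteq> insert (length I) (target b I)"
proof -
  have "small (I @ [x]) \<subseteq> insert (length I) (small I)"
    by (auto simp: small_def nth_append split: if_splits)
  then show ?thesis
    using kept_snoc[of b I x] by (auto simp: target_def)
qed

text \<open>There are at most \<open>slots b\<close> kept items, each of size at most
  \<open>1 / real (slots b)\<close>.\<close>

lemma load_kept_le_1: "load I (kept b I) \<le> 1"
proof -
  have "card (kept b I) \<le> slots b"
    unfolding kept_def by (intro card_smallest) auto
  then have le: "real (card (kept b I)) \<le> real (slots b)"
    by simp
  have "load I (kept b I) \<le> real (card (kept b I)) * (1 / real (slots b))"
    unfolding load_def using kept_subset[of b I]
    by (intro sum_bounded_above) (auto simp: in_class_def slots_def split: if_splits)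
  also have "\<dots> \<le> real (slots b) * (1 / real (slots b))"
    using le by (intro mult_right_mono) auto
  also have "\<dots> \<le> 1"
    by (simp add: slots_def)
  finally show ?thesis .
qed

text \<open>Discarding elements of \<open>S\<close> one at a time lowers the load by at most
  \<open>1 - \<tau>\<close> per step and ends at \<open>K\<close>, which fits. So the first load not
  above 1 is still at least \<tau>.\<close>

lemma overfull_imp_good:
  assumes "finite S" "finite K" "S \<inter> K = {}" "\<And>i. i \<in> S \<Longrightarrow> I ! i \<le> 1 - \<tau>"
    "load I K \<le> 1" "1 < load I (S \<union> K)"
  shows "\<exists>B\<subseteq>S \<union> K. good I B"
  using assms
proof (induction S rule: finite_induct)
  case (insert i S)
  have ins: "load I (insert i S \<union> K) = I ! i + load I (S \<union> K)"
    using insert by (simp add: load_def)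
  show ?case
  proof (cases "1 < load I (S \<union> K)")
    case True
    then have "\<exists>B\<subseteq>S \<union> K. good I B"
      using insert by auto
    then show ?thesis
      by blast
  next
    case False
    have "I ! i \<le> 1 - \<tau>"
      using insert by simp
    then have "good I (S \<union> K)"
      using False ins insert.prems(5) by (auto simp: good_def)
    then show ?thesis
      by blast
  qed
qed auto

section \<open>The invariant of a run\<close>

text \<open>Records that no arrival made a good packing reachable: \<open>take m I\<close> is what
  had been revealed when item \<open>m\<close> arrived. Using \<open>target\<close> instead of
  \<open>packing\<close> frees the competitive analysis from the recursion.\<close>

definition stuck :: "bool \<Rightarrow> real list \<Rightarrow> bool" where
  "stuck b I \<longleftrightarrow>
     (\<forall>m<length I. \<forall>B\<subseteq>insert m (target b (take m I)). \<not> good I B)"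

lemma stuck_snoc:
  assumes "stuck b I" "\<And>B. B \<subseteq> insert (length I) (target b I) \<Longrightarrow> \<not> good (I @ [x]) B"
  shows "stuck b (I @ [x])"
  unfolding stuck_def
proof (intro allI impI)
  fix m B
  assume m: "m < length (I @ [x])" and B: "B \<subseteq> insert m (target b (take m (I @ [x])))"
  show "\<not> good (I @ [x]) B"
  proof (cases "m = length I")
    case True
    then show ?thesis
      using assms B by simp
  next
    case False
    then have m: "m < length I"
      using m by simp
    then have B': "B \<subseteq> insert m (target b (take m I))"
      using B by simp
    then have "B \<subseteq> {..<length I}"
      using target_subset[of b "take m I"] m by force
    then show ?thesis
      using assms(1) m B' by (simp add: stuck_def good_append)
  qed
qed

text \<open>A good packing is itself a candidate at the next arrival, so goodness persists. A run
  that never becomes good has followed the target throughout and is stuck.\<close>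

lemma packing_invariant:
  assumes "remknap_instance I"
  shows "packing b I \<subseteq> {..<length I} \<and> load I (packing b I) \<le> 1 \<and>
    (good I (packing b I) \<or> packing b I = target b I \<and> stuck b I)"
  using assms
proof (induction I rule: rev_induct)
  case Nil
  show ?case
    by (auto simp: packing_Nil load_def stuck_def target_def small_def kept_def smallest_def)
next
  case (snoc x I)
  let ?J = "I @ [x]"
  let ?av = "insert (length I) (packing b I)"
  have "remknap_instance I"
    using snoc.prems by (simp add: remknap_instance_def)
  note IH = snoc.IH[OF this]
  show ?case
  proof (cases "\<exists>B\<subseteq>?av. good ?J B")
    case True
    then have eq: "packing b ?J = (SOME B. B \<subseteq> ?av \<and> good ?J B)"
      by (simp add: packing_snoc Let_def)
    have "packing b ?J \<subseteq> ?av \<and> good ?J (packing b ?J)"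
      unfolding eq by (rule someI_ex) (use True in blast)
    then show ?thesis
      using IH by (auto simp: good_def)
  next
    case False
    then have eq: "packing b ?J = target b ?J"
      by (simp only: packing_snoc Let_def False if_False)
    \<comment> \<open>Otherwise the old packing would be a good subset of
      \<open>?av\<close>.\<close>
    have "\<not> good I (packing b I)"
      using False IH good_append[of "packing b I" I "[x]"] by blast
    then have st: "packing b I = target b I" "stuck b I"
      using IH by auto
    have "load ?J (target b ?J) \<le> 1"
    \<comment> \<open>An overfull target contains a good subset, and \<open>target_snoc\<close>
      places it inside \<open>?av\<close>.\<close>
    proof (rule ccontr)
      assume "\<not> load ?J (target b ?J) \<le> 1"
      then have "\<exists>B\<subseteq>target b ?J. good ?J B"
        unfolding target_def
        by (intro overfull_imp_good finite_small finite_kept small_kept_disjoint load_kept_le_1)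
          (auto simp: small_def)
      then show False
        using False target_snoc[of b I x] st by blast
    qed
    moreover have "stuck b ?J"
      using st False by (intro stuck_snoc) auto
    ultimately show ?thesis
      using eq target_subset[of b ?J] by auto
  qed
qed

lemma packing_snoc_subset:
  assumes "remknap_instance (I @ [x])"
  shows "packing b (I @ [x]) \<subseteq> packing b I \<union> {length I}"
proof -
  let ?av = "insert (length I) (packing b I)"
  have I: "remknap_instance I"
    using assms by (simp add: remknap_instance_def)
  show ?thesis
  proof (cases "\<exists>B\<subseteq>?av. good (I @ [x]) B")
    case True
    then have eq: "packing b (I @ [x]) = (SOME B. B \<subseteq> ?av \<and> good (I @ [x]) B)"
      by (simp add: packing_snoc Let_def)
    have "packing b (I @ [x]) \<subseteq> ?av \<and> good (I @ [x]) (packing b (I @ [x]))"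
      unfolding eq by (rule someI_ex) (use True in blast)
    then show ?thesis
      by auto
  next
    case False
    then have eq: "packing b (I @ [x]) = target b (I @ [x])"
      by (simp only: packing_snoc Let_def False if_False)
    have "\<not> good I (packing b I)"
      using False packing_invariant[OF I, of b] good_append[of "packing b I" I "[x]"] by blast
    then show ?thesis
      using packing_invariant[OF I, of b] eq target_snoc[of b I x] by auto
  qed
qed

section \<open>Competitiveness\<close>

lemma kept_take:
  assumes "m \<le> length I"
  shows "kept b (take m I) = smallest (slots b) I {i. i < m \<and> in_class b (I ! i)}"
proof -
  have "{i. i < length (take m I) \<and> in_class b (take m I ! i)} = {i. i < m \<and> in_class b (I ! i)}"
    using assms by auto
  then show ?thesis
    unfolding kept_def by (simp only:) (intro smallest_cong, auto)
qed

lemma stuckD: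
  assumes "stuck b I" "m < length I" "B \<subseteq> insert m (kept b (take m I))"
  shows "\<not> good I B"
  using assms by (auto simp: stuck_def target_def)

lemma stuck_single:
  assumes "stuck b I" "m < length I" "I ! m \<le> 1"
  shows "I ! m < \<tau>"
  using stuckD[OF assms(1,2), of "{m}"] assms(3) by (auto simp: good_def load_def)

text \<open>When \<open>m\<close> arrives, some class item no larger than \<open>u\<close> is kept.
  Packing it with \<open>m\<close> was possible, so their total must miss the interval from \<tau>
  to 1.\<close>

lemma stuck_pair:
  assumes "stuck b I" "u < m" "m < length I" "in_class b (I ! u)"
  obtains p where "p < m" "in_class b (I ! p)" "I ! p \<le> I ! u"
    "I ! p + I ! m \<le> 1 \<Longrightarrow> I ! p + I ! m < \<tau>"
proof -
  obtain p where p: "p \<in> kept b (take m I)" "I ! p \<le> I ! u"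
    using ex_smallest_le[of "{i. i < m \<and> in_class b (I ! i)}" u "slots b" I] assms slots_pos
    by (auto simp: kept_take)
  then have p': "p < m" "in_class b (I ! p)"
    using kept_subset[of b "take m I"] by auto
  then have "load I {p, m} = I ! p + I ! m"
    by (simp add: load_def)
  then have "I ! p + I ! m \<le> 1 \<Longrightarrow> I ! p + I ! m < \<tau>"
    using stuckD[OF assms(1,3), of "{p, m}"] p by (auto simp: good_def)
  then show ?thesis
    using that p p' by blast
qed

text \<open>The same argument with both slots occupied when \<open>m\<close> arrives.\<close>

lemma stuck_triple:
  assumes "stuck False I" "u < m" "v < m" "m < length I" "u \<noteq> v"
    "in_class False (I ! u)" "in_class False (I ! v)"
  obtains p q where "in_class False (I ! p)" "in_class False (I ! q)"
    "I ! p + I ! q \<le> I ! u + I ! v"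
    "I ! p + I ! q + I ! m \<le> 1 \<Longrightarrow> I ! p + I ! q + I ! m < \<tau>"
proof -
  obtain p q where pq: "p \<in> kept False (take m I)" "q \<in> kept False (take m I)" "p \<noteq> q"
    "I ! p + I ! q \<le> I ! u + I ! v"
    using ex_two_smallest_le[of "{i. i < m \<and> in_class False (I ! i)}" u v "slots False" I] assms
    by (auto simp: kept_take slots_def)
  then have pq': "p < m" "q < m" "in_class False (I ! p)" "in_class False (I ! q)"
    using kept_subset[of False "take m I"] by auto
  then have "load I {p, q, m} = I ! p + I ! q + I ! m"
    using pq by (simp add: load_def)
  then have "I ! p + I ! q + I ! m \<le> 1 \<Longrightarrow> I ! p + I ! q + I ! m < \<tau>"
    using stuckD[OF assms(1,4), of "{p, q, m}"] pq by (auto simp: good_def)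
  then show ?thesis
    using that pq pq' by blast
qed

text \<open>If no item of the class precedes \<open>w\<close>, then \<open>w\<close> is still kept when the next one arrives.\<close>

lemma stuck_small_halves:
  assumes "stuck False I" "w < length I" "v < length I" "v \<noteq> w"
    "in_class False (I ! w)" "in_class False (I ! v)"
  shows "I ! w < 2 * \<tau> - 1"
proof (cases "\<exists>r<w. in_class False (I ! r)")
  case True
  then obtain r where "r < w" "in_class False (I ! r)"
    by blast
  then obtain p where "in_class False (I ! p)" "I ! p + I ! w \<le> 1 \<Longrightarrow> I ! p + I ! w < \<tau>"
    using stuck_pair[of False I r w] assms by blast
  \<comment> \<open>Both sizes are at most 1/2, so the pair fits and totals less than \<tau>, while
    \<open>p\<close> alone contributes more than \<open>1 - \<tau>\<close>.\<close>
  then show ?thesis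
    using assms by (auto simp: in_class_def)
next
  case False
  let ?P = "\<lambda>i. w < i \<and> in_class False (I ! i)"
  have v: "?P v"
    using False assms by (metis linorder_neqE_nat)
  define m where "m = (LEAST i. ?P i)"
  have m: "?P m"
    unfolding m_def using v by (rule LeastI)
  have "m \<le> v"
    unfolding m_def using v by (rule Least_le)
  then have "m < length I"
    using assms by simp
  then obtain p where p: "p < m" "in_class False (I ! p)"
    "I ! p + I ! m \<le> 1 \<Longrightarrow> I ! p + I ! m < \<tau>"
    using stuck_pair[of False I w m] assms m by blast
  have "\<not> ?P p"
    using p(1) unfolding m_def by (rule not_less_Least)
  \<comment> \<open>No class item precedes \<open>w\<close>, and by minimality of \<open>m\<close>
    none lies strictly between \<open>w\<close> and \<open>m\<close>.\<close>
  then have "p = w"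
    using False p by (metis linorder_neqE_nat)
  then show ?thesis
    using p m assms by (auto simp: in_class_def)
qed

lemma kept_True_ge_half:
  assumes "remknap_instance I" "c < length I" "in_class True (I ! c)"
  shows "1 / 2 \<le> load I (kept True I)"
proof -
  obtain p where p: "p \<in> kept True I"
    using ex_smallest_le[of "{i. i < length I \<and> in_class True (I ! i)}" c "slots True" I] assms
    by (auto simp: kept_def slots_def)
  then have "1 / 2 \<le> load I {p}"
    using kept_subset[of True I] by (auto simp: load_def in_class_def)
  also have "\<dots> \<le> load I (kept True I)"
    using p kept_subset[of True I] by (intro load_mono assms) auto
  finally show ?thesis .
qed

lemma kept_False_ge:
  assumes "remknap_instance I" "u < length I" "v < length I" "u \<noteq> v"
    "in_class False (I ! u)" "in_class False (I ! v)"
  shows "2 * (1 - \<tau>) \<le> load I (kept False I)"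
proof -
  obtain p q where pq: "p \<in> kept False I" "q \<in> kept False I" "p \<noteq> q"
    "I ! p + I ! q \<le> I ! u + I ! v"
    using ex_two_smallest_le[of "{i. i < length I \<and> in_class False (I ! i)}" u v "slots False" I]
      assms
    by (auto simp: kept_def slots_def)
  then have "in_class False (I ! p)" "in_class False (I ! q)"
    using kept_subset[of False I] by auto
  then have "2 * (1 - \<tau>) \<le> load I {p, q}"
    using pq by (simp add: load_def in_class_def)
  also have "\<dots> \<le> load I (kept False I)"
    using pq kept_subset[of False I] by (intro load_mono assms) auto
  finally show ?thesis .
qed

text \<open>Applied to the part of an optimal packing outside \<open>small I\<close>. The bit may
  depend on \<open>M\<close>, as the oracle sees the whole instance; being stuck under both bits
  lets either strategy supply contradictions.\<close>

lemma nonsmall_competitive: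
  assumes I: "remknap_instance I" and stuck: "\<And>b. stuck b I"
    and M: "M \<subseteq> {..<length I} - small I" "load I M \<le> 1"
  shows "\<exists>b. \<tau> * load I M \<le> load I (kept b I)"
proof -
  have M_len: "M \<subseteq> {..<length I}"
    using M by blast
  then have fin: "finite M"
    using finite_subset by blast
  have sub: "load I N \<le> 1" if "N \<subseteq> M" for N
    using load_mono[OF I that M_len] M by linarith
  have len: "i < length I" and big: "1 - \<tau> < I ! i" if "i \<in> M" for i
    using M that by (auto simp: small_def)
  have lt: "I ! i < \<tau>" if "i \<in> M" for i
    using sub[of "{i}"] stuck_single[OF stuck len] that by (simp add: load_def)
  have pair: "I ! i + I ! j \<le> 1" if "i \<in> M" "j \<in> M" "i \<noteq> j" for i j
    using sub[of "{i, j}"] that by (simp add: load_def)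
  show ?thesis
  proof (cases "\<exists>c\<in>M. 1 / 2 < I ! c")
    case True
    then obtain c where c: "c \<in> M" "1 / 2 < I ! c"
      by blast
    then have cc: "in_class True (I ! c)"
      using lt[of c] \<tau>_lt by (simp add: in_class_def)
    \<comment> \<open>A second item \<open>x\<close> would have let one of the two strategies reach
      a good pair, depending on whether \<open>x\<close> or \<open>c\<close> comes first.\<close>
    have "M = {c}"
    proof (rule ccontr)
      assume "M \<noteq> {c}"
      then obtain x where x: "x \<in> M" "x \<noteq> c"
        using c by blast
      have sum: "I ! x + I ! c \<le> 1"
        using pair x c by blast
      then have xc: "in_class False (I ! x)"
        using c big[OF x(1)] by (simp add: in_class_def)
      show False
      proof (cases "x < c")
        case True
        then obtain p where "in_class False (I ! p)" "I ! p \<le> I ! x"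
          "I ! p + I ! c \<le> 1 \<Longrightarrow> I ! p + I ! c < \<tau>"
          using stuck_pair[OF stuck _ len[OF c(1)] xc] by blast
        then show False
          \<comment> \<open>The pair fits because \<open>p\<close> is no larger than
            \<open>x\<close>, yet its load exceeds \<open>(1 - \<tau>) + 1 / 2\<close>, hence
            \<tau>.\<close>
          using sum c \<tau>_lt by (auto simp: in_class_def)
      next
        case False
        then have "c < x"
          using x by simp
        then obtain p where "in_class True (I ! p)" "I ! p \<le> I ! c"
          "I ! p + I ! x \<le> 1 \<Longrightarrow> I ! p + I ! x < \<tau>"
          using stuck_pair[OF stuck _ len[OF x(1)] cc] by blast
        then show False
          using sum big[OF x(1)] \<tau>_lt by (auto simp: in_class_def)
      qed
    qed
    then have "\<tau> * load I M \<le> \<tau> * \<tau>"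
      using lt[OF c(1)] \<tau>_pos by (intro mult_left_mono) (auto simp: load_def)
    also have "\<dots> \<le> load I (kept True I)"
      using kept_True_ge_half[OF I len[OF c(1)] cc] by (simp add: \<tau>_square)
    finally show ?thesis
      by blast
  next
    case False
    then have cls: "in_class False (I ! i)" if "i \<in> M" for i
      using that big by (force simp: in_class_def)
    have two: "2 * (1 - \<tau>) \<le> load I (kept False I)" if "u \<in> M" "v < length I"
      "in_class False (I ! v)" "u \<noteq> v" for u v
      using kept_False_ge[OF I] that len cls by blast
    \<comment> \<open>With three or more items, \<open>m\<close> is the last of them to arrive, so
      both others precede it.\<close>
    consider "M = {}" | u where "M = {u}" | u v where "M = {u, v}" "u \<noteq> v"
      | u v m where "{u, v, m} \<subseteq> M" "u \<noteq> v" "u < m" "v < m"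
    proof -
      consider "card M = 0" | "card M = 1" | "card M = 2" | "3 \<le> card M"
        by linarith
      then show thesis
      proof cases
        case 1
        then show ?thesis using fin that by simp
      next
        case 2
        then show ?thesis using that by (auto simp: card_1_singleton_iff)
      next
        case 3
        then show ?thesis using that by (auto simp: card_2_iff)
      next
        case 4
        then have "M \<noteq> {}"
          by auto
        then have m: "Max M \<in> M"
          using fin by simp
        have "2 \<le> card (M - {Max M})"
          using 4 m fin by simp
        then obtain T where "T \<subseteq> M - {Max M}" "card T = 2"
          using obtain_subset_with_card_n by metis
        then obtain u v where uv: "{u, v} \<subseteq> M - {Max M}" "u \<noteq> v"
          by (auto simp: card_2_iff)
        then have "u < Max M" "v < Max M"
          using fin by (auto simp: order_less_le)
        then show ?thesis
          using that(4)[of u v "Max M"] uv m by auto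
      qed
    qed
    then have "\<tau> * load I M \<le> load I (kept False I)"
    proof cases
      case 1
      have "0 \<le> load I (kept False I)"
        using load_mono[OF I, of "{}" "kept False I"] kept_subset[of False I]
        by (force simp: load_def)
      then show ?thesis
        using 1 by (simp add: load_def)
    next
      case 2
      \<comment> \<open>Other class items, even outside \<open>M\<close>, may displace
        \<open>u\<close>. But then two items are kept, with load at least
        \<open>2 * (1 - \<tau>)\<close>, which exceeds \<open>\<tau> / 2\<close>; otherwise
        \<open>u\<close> itself is kept.\<close>
      show ?thesis
      proof (cases "\<exists>v<length I. in_class False (I ! v) \<and> v \<noteq> u")
        case True
        then have "2 * (1 - \<tau>) \<le> load I (kept False I)"
          using two[of u] 2 by auto
        moreover have "\<tau> * load I M \<le> \<tau> * (1 / 2)"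
          using cls[of u] 2 \<tau>_pos by (intro mult_left_mono) (auto simp: load_def in_class_def)
        ultimately show ?thesis
          using \<tau>_lt by simp
      next
        case False
        obtain p where p: "p \<in> kept False I"
          using ex_smallest_le[of "{i. i < length I \<and> in_class False (I ! i)}" u "slots False" I]
            2 cls len
          by (auto simp: kept_def slots_def)
        then have "p = u"
          using kept_subset[of False I] False by auto
        then have "load I M \<le> load I (kept False I)"
          using 2 p kept_subset[of False I] by (intro load_mono I) auto
        moreover have "\<tau> * load I M \<le> 1 * load I M"
          using 2 cls[of u] \<tau>_lt by (intro mult_right_mono) (auto simp: load_def in_class_def)
        ultimately show ?thesis
          by simp
      qed
    next
      case 3
      then have "I ! u < 2 * \<tau> - 1" "I ! v < 2 * \<tau> - 1"
        using stuck_small_halves[OF stuck] len cls by auto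
      then have "\<tau> * load I M \<le> \<tau> * (2 * (2 * \<tau> - 1))"
        using 3 \<tau>_pos by (intro mult_left_mono) (auto simp: load_def)
      \<comment> \<open>The case without slack: among positive thresholds this equality holds only
        for the chosen \<tau>.\<close>
      also have "\<dots> = 2 * (1 - \<tau>)"
        using \<tau>_square by (simp add: algebra_simps)
      also have "\<dots> \<le> load I (kept False I)"
        using two[of u v] 3 len cls by auto
      finally show ?thesis .
    next
      case 4
      then obtain p q where pq: "in_class False (I ! p)" "in_class False (I ! q)"
        "I ! p + I ! q \<le> I ! u + I ! v"
        "I ! p + I ! q + I ! m \<le> 1 \<Longrightarrow> I ! p + I ! q + I ! m < \<tau>"
        using stuck_triple[OF stuck, of u m v] len cls by (metis insert_subset)
      have "I ! u + I ! v + I ! m \<le> 1"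
        using sub[OF 4(1)] 4 by (simp add: load_def)
      \<comment> \<open>The triple \<open>p\<close>, \<open>q\<close>, \<open>m\<close> fits since
        it is no heavier than \<open>u\<close>, \<open>v\<close>, \<open>m\<close>, but three sizes
        above \<open>1 - \<tau>\<close> total more than \<tau>.\<close>
      then have False
        using pq big[of m] 4 \<tau>_lt by (auto simp: in_class_def)
      then show ?thesis ..
    qed
    then show ?thesis
      by blast
  qed
qed

section \<open>From the non-small items to the optimum, and the advice bit\<close>

lemma opt_attained:
  obtains P where "P \<subseteq> {..<length I}" "load I P \<le> 1" "opt I = load I P"
proof -
  let ?L = "{load I P |P. P \<subseteq> {..<length I} \<and> load I P \<le> 1}"
  have "?L \<subseteq> load I ` Pow {..<length I}"
    by auto
  then have "finite ?L"
    by (rule finite_subset) simp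
  moreover have "load I {} \<in> ?L"
    by (auto simp: load_def intro!: exI[of _ "{}"])
  ultimately have "opt I \<in> ?L"
    unfolding opt_def by (intro Max_in) auto
  then show ?thesis
    using that by blast
qed

lemma packing_competitive:
  assumes I: "remknap_instance I"
  shows "\<exists>b. opt I \<le> sqrt 2 * load I (packing b I)"
proof -
  obtain P where P: "P \<subseteq> {..<length I}" "load I P \<le> 1" "opt I = load I P"
    by (rule opt_attained)
  have "\<exists>b. \<tau> * load I P \<le> load I (packing b I)"
  proof (cases "\<exists>b. good I (packing b I)")
    case True
    have "\<tau> * load I P \<le> \<tau> * 1"
      using P \<tau>_pos by (intro mult_left_mono) auto
    then show ?thesis
      using True by (auto simp: good_def intro: order_trans)
  next
    case False
    then have st: "packing b I = target b I" "stuck b I" for b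
      using packing_invariant[OF I, of b] by auto
    have fin: "finite P"
      using P finite_subset by blast
    have P_le: "load I (P - small I) \<le> 1"
      using load_mono[OF I, of "P - small I" P] P by auto
    obtain b where b: "\<tau> * load I (P - small I) \<le> load I (kept b I)"
      using nonsmall_competitive[OF I st(2) _ P_le] P by blast
    \<comment> \<open>The small part of the optimum is covered in full by \<open>small I\<close>, so
      the factor \<tau> is lost only on the remaining part.\<close>
    have "load I P = load I (P \<inter> small I) + load I (P - small I)"
      using fin by (subst load_Un_disjoint[symmetric]) (auto simp: Int_Diff_Un)
    moreover have "0 \<le> load I (P \<inter> small I)"
      using load_mono[OF I, of "{}" "P \<inter> small I"] P by (force simp: load_def)
    then have "\<tau> * load I (P \<inter> small I) \<le> 1 * load I (P \<inter> small I)"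
      using \<tau>_lt by (intro mult_right_mono) auto
    moreover have "load I (P \<inter> small I) \<le> load I (small I)"
      using small_subset by (intro load_mono I) auto
    moreover have "load I (packing b I) = load I (small I) + load I (kept b I)"
      unfolding st target_def
      by (intro load_Un_disjoint finite_small finite_kept small_kept_disjoint)
    ultimately show ?thesis
      using b by (auto simp: distrib_left intro!: exI[of _ b])
  qed
  then obtain b where "\<tau> * load I P \<le> load I (packing b I)"
    by blast
  then have "sqrt 2 * (\<tau> * load I P) \<le> sqrt 2 * load I (packing b I)"
    by (intro mult_left_mono) auto
  then show ?thesis
    using P sqrt2_mult_\<tau> by auto
qed

theorem theorem4:
  "\<exists>(alg :: advice_algorithm) (oracle_advice :: real list \<Rightarrow> advice).
     remknap_algorithm alg \<and> reads_at_most 1 alg \<and>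
     strictly_competitive (sqrt 2) alg oracle_advice"
proof -
  define alg :: advice_algorithm where "alg = (\<lambda>\<phi>. packing (\<phi> 0))"
  \<comment> \<open>The tape repeats one bit, a choice that \<open>packing_competitive\<close> shows
    to exist; \<open>alg\<close> consults position 0 alone.\<close>
  define adv :: "real list \<Rightarrow> advice" where
    "adv = (\<lambda>I _. SOME b. opt I \<le> sqrt 2 * load I (packing b I))"
  have "remknap_algorithm alg"
    using packing_snoc_subset packing_invariant
    by (auto simp: remknap_algorithm_def alg_def packing_Nil)
  moreover have "reads_at_most 1 alg"
    by (auto simp: reads_at_most_def alg_def)
  moreover have "strictly_competitive (sqrt 2) alg adv"
    unfolding strictly_competitive_def
  proof (intro allI impI)
    fix I assume I: "remknap_instance I"
    \<comment> \<open>Nonnegativity lets \<open>ereal_ratio_le_iff\<close> replace the quotient by a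
      product, including the case of zero gain.\<close>
    have nonneg: "0 \<le> load I Q" if "Q \<subseteq> {..<length I}" for Q
      using load_mono[OF I, of "{}" Q] that by (simp add: load_def)
    have "opt I \<le> sqrt 2 * gain alg (adv I) I"
      using someI_ex[OF packing_competitive[OF I]] by (simp add: gain_def alg_def adv_def)
    moreover have "0 \<le> opt I"
      using nonneg opt_attained[of I] by metis
    moreover have "0 \<le> gain alg (adv I) I"
      unfolding gain_def alg_def using packing_invariant[OF I] by (intro nonneg) blast
    ultimately show "ereal (opt I) / ereal (gain alg (adv I) I) \<le> ereal (sqrt 2)"
      by (subst ereal_ratio_le_iff) auto
  qed
  ultimately show ?thesis
    by blast
qed

end
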